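(* Let $G$ be a Polish group admitting an invariant metric. Then every $\mathcal M$-additive set in $G$ is universally meager.
   Context: A Polish group is a topological group whose topology is separable and completely metrizable. An invariant metric is a metric compatible with the topology that is both left- and right-invariant. A set is meager if it is a countable union of nowhere dense sets. A set $X\subseteq G$ is $\mathcal M$-additive (meager-additive) if $MX=\{mx:m\in M,x\in X\}$ is meager for every meager set $M\subseteq G$. A separable metric space $E$ is universally meager if for any perfect Polish spaces $Y,X$ (Polish spaces without isolated points) such that $E\subseteq X$ (as a subspace) and every continuous one-to-one mapping $f:Y\to X$, the set $f^{-1}(E)$ is meager in $Y$. A subset of $G$ is called universally meager if it is so as a subspace. *)

theory Defs
  imports "HOL-Analysis.Analysis" "HOL-Algebra.Coset"
begin

definition nowhere_dense_in :: "'a topology \<Rightarrow> 'a set \<Rightarrow> bool" where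
  "nowhere_dense_in T N \<longleftrightarrow> N \<subseteq> topspace T \<and> T interior_of (T closure_of N) = {}"

definition meager_in :: "'a topology \<Rightarrow> 'a set \<Rightarrow> bool" where
  "meager_in T M \<longleftrightarrow>
     (\<exists>N :: nat \<Rightarrow> 'a set. (\<forall>n. nowhere_dense_in T (N n)) \<and> M = (\<Union>n. N n))"

definition Polish_topology :: "'a topology \<Rightarrow> bool" where
  "Polish_topology T \<longleftrightarrow> completely_metrizable_space T \<and> separable_space T"

definition perfect_Polish_topology :: "'a topology \<Rightarrow> bool" where
  "perfect_Polish_topology T \<longleftrightarrow>
     Polish_topology T \<and> (\<forall>x \<in> topspace T. \<not> openin T {x})"

locale topological_group = group G for G :: "('g, 'm) monoid_scheme" (structure) +
  fixes T :: "'g topology"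
  assumes topspace_eq_carrier: "topspace T = carrier G"
    and continuous_mult: "continuous_map (prod_topology T T) T (\<lambda>(x, y). x \<otimes> y)"
    and continuous_inv: "continuous_map T T (\<lambda>x. inv x)"

locale Polish_group = topological_group +
  assumes Polish: "Polish_topology T"

definition invariant_metric ::
    "('g, 'm) monoid_scheme \<Rightarrow> 'g topology \<Rightarrow> ('g \<Rightarrow> 'g \<Rightarrow> real) \<Rightarrow> bool" where
  "invariant_metric G T d \<longleftrightarrow>
     Metric_space (carrier G) d \<and> Metric_space.mtopology (carrier G) d = T \<and>
     (\<forall>g \<in> carrier G. \<forall>x \<in> carrier G. \<forall>y \<in> carrier G.
        d (g \<otimes>\<^bsub>G\<^esub> x) (g \<otimes>\<^bsub>G\<^esub> y) = d x y \<and> d (x \<otimes>\<^bsub>G\<^esub> g) (y \<otimes>\<^bsub>G\<^esub> g) = d x y)"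

definition meager_additive ::
    "('g, 'm) monoid_scheme \<Rightarrow> 'g topology \<Rightarrow> 'g set \<Rightarrow> bool" where
  "meager_additive G T X \<longleftrightarrow>
     X \<subseteq> carrier G \<and> (\<forall>M. meager_in T M \<longrightarrow> meager_in T (M <#>\<^bsub>G\<^esub> X))"

(* HOL cannot quantify over types inside a formula, so the types carrying the Polish spaces
   Y and X are parameters. Universal meagerness of E is the assertion for arbitrary types 'y
   and 'x; as the conclusion of a theorem in which 'y and 'x are free type variables it
   ranges over all Y and X. That E is a subspace of X is expressed by a homeomorphic
   embedding e of E into X, so the preimage of E under f is {y. f y \<in> e ` E}. *)
definition universally_meager ::
    "'y itself \<Rightarrow> 'x itself \<Rightarrow> 'e topology \<Rightarrow> bool" where
  "universally_meager _ _ E \<longleftrightarrow>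
     metrizable_space E \<and> separable_space E \<and>
     (\<forall>(Y :: 'y topology) (X :: 'x topology) e f.
        perfect_Polish_topology Y \<and> perfect_Polish_topology X \<and>
        embedding_map E X e \<and>
        continuous_map Y X f \<and> inj_on f (topspace Y) \<longrightarrow>
        meager_in Y {y \<in> topspace Y. f y \<in> e ` topspace E})"

end

theory Submission
  imports Defs
begin

text \<open>
  Write \<open>P\<close> for the preimage of the meager-additive set \<open>A\<close> in the perfect Polish space \<open>Y\<close>. The
  given injection, followed by the inverse of the embedding of \<open>A\<close>, maps \<open>P\<close> injectively into \<open>A\<close>.
  After a nowhere dense part of \<open>P\<close> is discarded, Lavrentiev's theorem extends this map to a
  continuous map \<open>h\<close> into the group, defined on a completely metrizable space and not constant on any
  nonempty open set (\<open>meager_injective_preimage\<close>).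

  The heart of the proof (\<open>thick_nowhere_dense_set\<close>) is a closed nowhere dense set \<open>N\<close> in the group,
  built from \<open>h\<close> alone, such that the products of any nonempty relatively open piece of \<open>N\<close> with the
  image under \<open>h\<close> of any nonempty open set have nonempty interior. Given \<open>N\<close>, additivity covers the
  products of \<open>N\<close> and \<open>A\<close> by countably many closed sets without interior, and Baire's theorem in \<open>N\<close>
  distributes \<open>P\<close> over countably many closed sets, on each of which the products of one fixed piece of
  \<open>N\<close> with the images stay in a single such closed set; so none of these sets has interior
  (\<open>closed_cover_of_preimage\<close>), and \<open>P\<close> is meager.

  To construct \<open>N\<close>, take scales \<open>e k\<close> that decrease quickly, a maximal \<open>e k\<close>-separated set \<open>R k\<close>
  for each \<open>k\<close>, and delete from the group the balls of the much smaller radius \<open>e (k + 1)\<close> around the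
  points of \<open>R k\<close>. What remains is nowhere dense; \<open>N\<close> is the closure of the set of those remaining
  points that keep some additional distance from the deleted balls. That \<open>N\<close> is still large follows
  from the choice of the scales: \<open>e (k + 1)\<close> is so small that each of finitely many open sets treated up to stage
  \<open>k\<close> contains two small open sets with images at distance more than \<open>4 * e (k + 1)\<close>
  (\<open>branching_scheme_exists\<close>). For a target \<open>z\<close>, invariance of the metric shows that the deleted
  balls of stage \<open>k\<close> can obstruct the quotients \<open>z \<otimes> inv (h y)\<close> for \<open>y\<close> in at most one of the two
  (\<open>avoid_net\<close>). Following the unobstructed sets through all stages leads to a \<open>y\<close> for which the
  quotient escapes all deletions (\<open>avoid_all_nets\<close>), and \<open>z\<close> is the product of that quotient and
  \<open>h y\<close>.
\<close>

section \<open>Nowhere dense and meager sets\<close>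

lemma nowhere_dense_in_subset:
  assumes "nowhere_dense_in X N" "S \<subseteq> N"
  shows "nowhere_dense_in X S"
  using assms interior_of_mono [OF closure_of_mono [OF assms(2)], of X X]
  unfolding nowhere_dense_in_def by blast

lemma meager_in_countable_cover:
  assumes "countable \<C>" "\<And>C. C \<in> \<C> \<Longrightarrow> nowhere_dense_in X C" "P \<subseteq> \<Union>\<C>"
  shows "meager_in X P"
proof -
  have empty: "nowhere_dense_in X {}"
    by (simp add: nowhere_dense_in_def)
  define D where "D = from_nat_into (insert {} \<C>)"
  have range_D: "range D = insert {} \<C>"
    unfolding D_def using assms(1) by (intro range_from_nat_into) auto
  have "nowhere_dense_in X (P \<inter> D n)" for n
  proof (rule nowhere_dense_in_subset [of X "D n"])
    have "D n \<in> insert {} \<C>"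
      using range_D by blast
    then show "nowhere_dense_in X (D n)"
      using assms(2) empty by auto
  qed simp
  moreover have "P = (\<Union>n. P \<inter> D n)"
    using assms(3) range_D by auto
  ultimately show ?thesis
    unfolding meager_in_def by (intro exI [of _ "\<lambda>n. P \<inter> D n"]) auto
qed

text \<open>
  An open set in which \<open>C\<close> is dense meets \<open>U\<close> only inside \<open>C\<close>, because \<open>C\<close> is closed relative
  to \<open>U\<close>.
\<close>

lemma nowhere_dense_in_subspaceD:
  assumes C: "closedin (subtopology X U) C" "subtopology X U interior_of C = {}"
  shows "nowhere_dense_in X C"
proof -
  have CU: "C \<subseteq> U" and C_top: "C \<subseteq> topspace X"
    using closedin_subset [OF C(1)] by auto
  let ?O = "X interior_of (X closure_of C)"
  have "?O = {}"
  proof (rule ccontr)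
    assume "?O \<noteq> {}"
    then obtain x where x: "x \<in> ?O" "x \<in> X closure_of C"
      using interior_of_subset [of X "X closure_of C"] by blast
    then obtain c where c: "c \<in> C" "c \<in> ?O"
      unfolding in_closure_of by (meson openin_interior_of)
    have "?O \<inter> U \<subseteq> (X closure_of C) \<inter> U"
      using interior_of_subset [of X "X closure_of C"] by blast
    also have "\<dots> = C"
      using CU closure_of_closedin [OF C(1)] by (simp add: closure_of_subtopology_open Int_commute)
    finally have "?O \<inter> U \<subseteq> subtopology X U interior_of C"
      by (intro interior_of_maximal openin_subtopology_Int openin_interior_of)
    then show False
      using C(2) c CU by blast
  qed
  then show ?thesis
    using C_top unfolding nowhere_dense_in_def by simp
qed

section \<open>Countable bases and separated nets\<close>

lemma (in Metric_space) separable_imp_second_countable: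
  assumes "separable_space mtopology"
  shows "second_countable mtopology"
proof -
  obtain C where C: "countable C" "C \<subseteq> M" and dense: "mtopology closure_of C = M"
    using assms unfolding separable_space_def by auto
  define \<B> where "\<B> = (\<lambda>(c, n). mball c (1 / real (Suc n))) ` (C \<times> (UNIV :: nat set))"
  have "\<exists>V\<in>\<B>. x \<in> V \<and> V \<subseteq> U" if U: "openin mtopology U" "x \<in> U" for U x
  proof -
    obtain r where r: "0 < r" "mball x r \<subseteq> U" and x: "x \<in> M"
      using U unfolding openin_mtopology by blast
    obtain n where n: "1 / real (Suc n) < r / 2"
      using reals_Archimedean [OF half_gt_zero [OF r(1)]] by (auto simp: inverse_eq_divide)
    have "x \<in> mtopology closure_of C" "0 < 1 / real (Suc n)"
      using x dense by simp_all
    then obtain c where c: "c \<in> C" and xc: "c \<in> mball x (1 / real (Suc n))"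
      unfolding metric_closure_of by blast
    then have "d x c < 1 / real (Suc n)" and cM: "c \<in> M"
      by simp_all
    then have dist: "d c x < 1 / real (Suc n)"
      using commute [of c x] by linarith
    have "d c x + 1 / real (Suc n) \<le> r"
      using dist n by linarith
    then have "mball c (1 / real (Suc n)) \<subseteq> mball x r"
      using x by (rule mball_subset)
    moreover have "x \<in> mball c (1 / real (Suc n))"
      unfolding in_mball using dist cM x by blast
    moreover have "mball c (1 / real (Suc n)) \<in> \<B>"
      unfolding \<B>_def using c by (intro image_eqI [of _ _ "(c, n)"]) simp_all
    ultimately show ?thesis
      using r(2) by blast
  qed
  moreover have "countable \<B>"
    unfolding \<B>_def using C by simp
  moreover have "\<forall>V\<in>\<B>. openin mtopology V"
    unfolding \<B>_def by auto
  ultimately show ?thesis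
    unfolding second_countable_def by (intro exI [of _ \<B>]) simp
qed

lemma metrizable_separable_imp_second_countable:
  assumes "metrizable_space X" "separable_space X"
  shows "second_countable X"
proof -
  obtain M d where "Metric_space M d" "X = Metric_space.mtopology M d"
    using assms(1) unfolding metrizable_space_def by blast
  then show ?thesis
    using assms(2) Metric_space.separable_imp_second_countable by blast
qed

lemma Polish_topology_second_countable: "Polish_topology X \<Longrightarrow> second_countable X"
  unfolding Polish_topology_def
  by (intro metrizable_separable_imp_second_countable) (auto intro: completely_metrizable_imp_metrizable_space)

definition (in Metric_space) separated_net :: "real \<Rightarrow> 'a set \<Rightarrow> bool" where
  "separated_net e R \<longleftrightarrow>
     R \<subseteq> M \<and> (\<forall>q\<in>R. \<forall>q'\<in>R. d q q' < e \<longrightarrow> q = q') \<and> (\<forall>x\<in>M. \<exists>q\<in>R. d x q < e)"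

text \<open>
  A maximal set with pairwise distances at least \<open>e\<close>, given by Zorn's lemma, comes within \<open>e\<close> of
  every point, since otherwise a point could be added to it.
\<close>

lemma (in Metric_space) separated_net_exists:
  assumes "0 < e"
  shows "\<exists>R. separated_net e R"
proof -
  define \<S> where "\<S> = {R. R \<subseteq> M \<and> (\<forall>r\<in>R. \<forall>s\<in>R. d r s < e \<longrightarrow> r = s)}"
  have "\<exists>R\<in>\<S>. \<forall>S\<in>\<S>. R \<subseteq> S \<longrightarrow> S = R"
  proof (rule subset_Zorn_nonempty)
    show "\<S> \<noteq> {}"
      unfolding \<S>_def by (intro ex_in_conv [THEN iffD1] exI [of _ "{}"]) simp
    show "\<Union> \<C> \<in> \<S>" if "\<C> \<noteq> {}" "subset.chain \<S> \<C>" for \<C>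
    proof -
      have sub: "\<C> \<subseteq> \<S>" and lin: "\<And>A B. A \<in> \<C> \<Longrightarrow> B \<in> \<C> \<Longrightarrow> A \<subseteq> B \<or> B \<subseteq> A"
        using that unfolding subset_chain_def by auto
      have "r = s" if rs: "r \<in> A" "A \<in> \<C>" "s \<in> B" "B \<in> \<C>" "d r s < e" for r s A B
      proof -
        have "\<exists>D\<in>\<S>. r \<in> D \<and> s \<in> D"
          using lin [OF rs(2,4)] sub rs by auto
        then show ?thesis
          using rs(5) unfolding \<S>_def by auto
      qed
      moreover have "\<Union> \<C> \<subseteq> M"
        using sub unfolding \<S>_def by auto
      ultimately show ?thesis
        unfolding \<S>_def by auto
    qed
  qed
  then obtain R where R: "R \<in> \<S>" and max: "\<And>S. S \<in> \<S> \<Longrightarrow> R \<subseteq> S \<Longrightarrow> S = R"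
    by blast
  have "\<exists>r\<in>R. d x r < e" if "x \<in> M" for x
  proof (rule ccontr)
    assume far: "\<not> (\<exists>r\<in>R. d x r < e)"
    then have "insert x R \<in> \<S>"
      using R that unfolding \<S>_def by (auto simp: commute)
    then have "x \<in> R"
      using max by blast
    then show False
      using far that assms by auto
  qed
  moreover have "R \<subseteq> M" "\<forall>q\<in>R. \<forall>q'\<in>R. d q q' < e \<longrightarrow> q = q'"
    using R unfolding \<S>_def by auto
  ultimately show ?thesis
    unfolding separated_net_def by blast
qed

section \<open>Groups with an invariant metric\<close>

locale invariant_metric_group =
  group G + Metric_space "carrier G" d for G (structure) and d +
  assumes left_invariant:
      "\<lbrakk>g \<in> carrier G; x \<in> carrier G; y \<in> carrier G\<rbrakk> \<Longrightarrow> d (g \<otimes> x) (g \<otimes> y) = d x y"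
    and right_invariant:
      "\<lbrakk>g \<in> carrier G; x \<in> carrier G; y \<in> carrier G\<rbrakk> \<Longrightarrow> d (x \<otimes> g) (y \<otimes> g) = d x y"
begin

text \<open>
  A product \<open>m \<otimes> g\<close> hits a target \<open>x\<close> exactly when \<open>m = x \<otimes> inv g\<close>. Membership of such quotients in
  a set that is described by distances is therefore a matter of distances from \<open>x\<close> to translates.
\<close>

lemma dist_divide:
  assumes "x \<in> carrier G" "y \<in> carrier G" "g \<in> carrier G"
  shows "d (x \<otimes> inv g) y = d x (y \<otimes> g)"
proof -
  have "d (x \<otimes> inv g) y = d (x \<otimes> inv g \<otimes> g) (y \<otimes> g)"
    using assms by (simp add: right_invariant)
  then show ?thesis
    using assms by (simp add: m_assoc)
qed

lemma continuous_left_translation: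
  assumes "g \<in> carrier G"
  shows "continuous_map mtopology mtopology (\<lambda>x. g \<otimes> x)"
  unfolding continuous_map_def topspace_mtopology
proof (intro conjI allI impI)
  show "(\<lambda>x. g \<otimes> x) \<in> carrier G \<rightarrow> carrier G"
    using assms by simp
  fix U
  assume U: "openin mtopology U"
  have "\<exists>r>0. mball x r \<subseteq> {x \<in> carrier G. g \<otimes> x \<in> U}" if x: "x \<in> carrier G" "g \<otimes> x \<in> U" for x
  proof -
    obtain r where r: "0 < r" "mball (g \<otimes> x) r \<subseteq> U"
      using U x(2) unfolding openin_mtopology by blast
    have "g \<otimes> y \<in> U" if "y \<in> mball x r" for y
      using r(2) that assms x by (auto simp: subset_iff left_invariant)
    then show ?thesis
      using r(1) by (intro exI [of _ r]) auto
  qed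
  then show "openin mtopology {x \<in> carrier G. g \<otimes> x \<in> U}"
    unfolding openin_mtopology by blast
qed

lemma continuous_right_translation:
  assumes "g \<in> carrier G"
  shows "continuous_map mtopology mtopology (\<lambda>x. x \<otimes> g)"
  unfolding continuous_map_def topspace_mtopology
proof (intro conjI allI impI)
  show "(\<lambda>x. x \<otimes> g) \<in> carrier G \<rightarrow> carrier G"
    using assms by simp
  fix U
  assume U: "openin mtopology U"
  have "\<exists>r>0. mball x r \<subseteq> {x \<in> carrier G. x \<otimes> g \<in> U}" if x: "x \<in> carrier G" "x \<otimes> g \<in> U" for x
  proof -
    obtain r where r: "0 < r" "mball (x \<otimes> g) r \<subseteq> U"
      using U x(2) unfolding openin_mtopology by blast
    have "y \<otimes> g \<in> U" if "y \<in> mball x r" for y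
      using r(2) that assms x by (auto simp: subset_iff right_invariant)
    then show ?thesis
      using r(1) by (intro exI [of _ r]) auto
  qed
  then show "openin mtopology {x \<in> carrier G. x \<otimes> g \<in> U}"
    unfolding openin_mtopology by blast
qed

end

section \<open>Splitting open sets along a map that is nowhere constant\<close>

text \<open>
  This is the situation to which the theorem is reduced. The extension of an injective map to a
  larger domain need not be injective; but if the original domain is dense and has no isolated
  points, then the extension is still not constant on any nonempty open set.
\<close>

locale nowhere_constant_map =
  invariant_metric_group G d + Y: Metric_space Y \<rho>
  for G (structure) and d and Y :: "'y set" and \<rho> +
  fixes h :: "'y \<Rightarrow> 'a"
  assumes complete: "Y.mcomplete"
    and countable_base: "second_countable Y.mtopology"
    and nonempty: "Y \<noteq> {}"
    and continuous: "continuous_map Y.mtopology mtopology h"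
    and nonconstant: "\<lbrakk>openin Y.mtopology U; U \<noteq> {}\<rbrakk> \<Longrightarrow> \<exists>a\<in>U. \<exists>b\<in>U. h a \<noteq> h b"
begin

lemma h_carrier [simp]: "y \<in> Y \<Longrightarrow> h y \<in> carrier G"
  using continuous by (auto simp: continuous_map_def)

lemma openin_Y_subset: "openin Y.mtopology U \<Longrightarrow> U \<subseteq> Y"
  using openin_subset by fastforce

lemma small_ball:
  assumes "openin Y.mtopology U" "a \<in> U" "0 < e" "0 < s"
  obtains r where "0 < r" "r \<le> s" "Y.mcball a r \<subseteq> U"
    "\<forall>y \<in> Y.mball a r. d (h a) (h y) < e"
proof -
  have a: "a \<in> Y"
    using assms openin_Y_subset by blast
  define V where "V = U \<inter> {y \<in> topspace Y.mtopology. h y \<in> mball (h a) e}"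
  have "openin Y.mtopology V"
    unfolding V_def using assms
    by (intro openin_Int openin_continuous_map_preimage [OF continuous]) auto
  moreover have "a \<in> V"
    using a assms by (simp add: V_def)
  ultimately obtain r where r: "0 < r" "Y.mcball a r \<subseteq> V"
    unfolding Y.openin_mtopology_mcball by blast
  show thesis
  proof (rule that)
    show "0 < min r s" "min r s \<le> s"
      using r assms by auto
    show "Y.mcball a (min r s) \<subseteq> U"
      using r unfolding V_def by (force simp: subset_iff)
    show "\<forall>y \<in> Y.mball a (min r s). d (h a) (h y) < e"
    proof
      fix y
      assume "y \<in> Y.mball a (min r s)"
      then have "y \<in> Y.mcball a r"
        by auto
      then show "d (h a) (h y) < e"
        using r(2) unfolding V_def by auto
    qed
  qed
qed

lemma shrink:
  assumes "openin Y.mtopology U" "U \<noteq> {}" "0 < e"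
  shows "\<exists>V. openin Y.mtopology V \<and> V \<noteq> {} \<and> V \<subseteq> U \<and> (\<forall>x\<in>V. \<forall>y\<in>V. d (h x) (h y) \<le> e)"
proof -
  obtain a where a: "a \<in> U" "a \<in> Y"
    using assms openin_Y_subset by blast
  obtain r where r: "0 < r" "Y.mcball a r \<subseteq> U"
    and close: "\<forall>y \<in> Y.mball a r. d (h a) (h y) < e / 2"
    using small_ball [OF assms(1) a(1) half_gt_zero [OF assms(3)] zero_less_one] by metis
  have "d (h x) (h y) \<le> e" if "x \<in> Y.mball a r" "y \<in> Y.mball a r" for x y
  proof -
    have "d (h x) (h y) \<le> d (h a) (h x) + d (h a) (h y)"
      using that a by (intro triangle'') auto
    moreover have "d (h a) (h x) < e / 2" "d (h a) (h y) < e / 2"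
      using that close by blast+
    ultimately show ?thesis
      by linarith
  qed
  moreover have "Y.mball a r \<noteq> {}" "Y.mball a r \<subseteq> U"
    using r a Y.mball_subset_mcball by (auto simp: Y.mball_eq_empty)
  ultimately show ?thesis
    by (intro exI [of _ "Y.mball a r"]) simp
qed

text \<open>
  The images of the two balls have to be distinguishable at the scale \<open>c\<close>, yet lie so close at the
  scale \<open>e\<close> that they cannot be near different points of an \<open>e\<close>-separated set. Closed balls inside
  \<open>U\<close> and geometrically decreasing radii make infinitely many successive choices determine a point
  of the complete space.
\<close>

definition splits :: "nat \<Rightarrow> real \<Rightarrow> real \<Rightarrow> 'y set \<Rightarrow> 'y set set \<Rightarrow> bool" where
  "splits k e c U \<W> \<longleftrightarrow>
     (\<exists>a b r. 0 < r \<and> r \<le> (1/2)^k \<and> Y.mcball a r \<subseteq> U \<and> Y.mcball b r \<subseteq> U \<and> a \<in> Y \<and> b \<in> Y \<and>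
        Y.mball a r \<in> \<W> \<and> Y.mball b r \<in> \<W> \<and>
        (\<forall>x \<in> Y.mball a r. \<forall>y \<in> Y.mball b r. d (h x) (h y) \<le> e / 4 \<and> 4 * c < d (h x) (h y)))"

lemma splits_mono:
  assumes "splits k e c U \<W>" "c' \<le> c" "\<W> \<subseteq> \<W>'"
  shows "splits k e c' U \<W>'"
proof -
  have "4 * c' < t" if "4 * c < t" for t
    using assms(2) that by linarith
  then show ?thesis
    using assms(1,3) unfolding splits_def by (meson subsetD)
qed

lemma splits_exists:
  assumes U: "openin Y.mtopology U" "U \<noteq> {}" and e: "0 < e"
  shows "\<exists>c \<W>. 0 < c \<and> finite \<W> \<and> (\<forall>W\<in>\<W>. openin Y.mtopology W \<and> W \<noteq> {}) \<and> splits k e c U \<W>"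
proof -
  obtain V where V: "openin Y.mtopology V" "V \<noteq> {}" "V \<subseteq> U"
      "\<forall>x\<in>V. \<forall>y\<in>V. d (h x) (h y) \<le> e / 4"
    using shrink [OF U, of "e / 4"] e by auto
  obtain a b where ab: "a \<in> V" "b \<in> V" "h a \<noteq> h b"
    using nonconstant [OF V(1,2)] by blast
  have abY: "a \<in> Y" "b \<in> Y"
    using ab V openin_Y_subset by blast+
  define q where "q = d (h a) (h b)"
  have q: "0 < q"
    unfolding q_def using ab abY by simp
  obtain r1 where r1: "0 < r1" "r1 \<le> (1/2)^k" "Y.mcball a r1 \<subseteq> V"
      "\<forall>y \<in> Y.mball a r1. d (h a) (h y) < q / 4"
    using small_ball [OF V(1) ab(1), of "q / 4" "(1/2)^k"] q by (metis divide_pos_pos zero_less_numeral zero_less_power zero_less_one)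
  obtain r2 where r2: "0 < r2" "r2 \<le> (1/2)^k" "Y.mcball b r2 \<subseteq> V"
      "\<forall>y \<in> Y.mball b r2. d (h b) (h y) < q / 4"
    using small_ball [OF V(1) ab(2), of "q / 4" "(1/2)^k"] q by (metis divide_pos_pos zero_less_numeral zero_less_power zero_less_one)
  define r where "r = min r1 r2"
  have r: "0 < r" "r \<le> r1" "r \<le> r2"
    using r1 r2 by (auto simp: r_def)
  have sub: "Y.mcball a r \<subseteq> V" "Y.mcball b r \<subseteq> V"
    using r1(3) r2(3) Y.mcball_subset_concentric r(2,3) by blast+
  have far: "d (h x) (h y) \<le> e / 4 \<and> 4 * (q / 8) < d (h x) (h y)"
    if x: "x \<in> Y.mball a r" and y: "y \<in> Y.mball b r" for x y
  proof
    have "x \<in> V" "y \<in> V"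
      using x y sub Y.mball_subset_mcball by blast+
    then show "d (h x) (h y) \<le> e / 4"
      using V(4) by blast
    have "d (h a) (h x) < q / 4" "d (h b) (h y) < q / 4"
      using r1(4) r2(4) r x y by auto
    moreover have "q \<le> d (h a) (h x) + d (h x) (h y) + d (h b) (h y)"
      unfolding q_def using x y abY
        triangle [of "h a" "h x" "h b"] triangle' [of "h x" "h y" "h b"]
      by (auto simp: commute)
    ultimately show "4 * (q / 8) < d (h x) (h y)"
      by linarith
  qed
  show ?thesis
  proof (intro exI conjI ballI)
    show "splits k e (q / 8) U {Y.mball a r, Y.mball b r}"
      unfolding splits_def
      using r r1 far sub V(3) abY
      by (intro exI [of _ a] exI [of _ b] exI [of _ r]) auto
    show "openin Y.mtopology W" "W \<noteq> {}" if "W \<in> {Y.mball a r, Y.mball b r}" for W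
      using that r abY by (auto simp: Y.mball_eq_empty)
  qed (use q in auto)
qed

text \<open>
  The new scale is chosen once the finitely many members of \<open>F\<close> have been split, and the shrunken
  copies of the first basic sets \<open>B i\<close> are chosen after the scale. Finiteness of the families is
  what makes a positive common scale possible.
\<close>

lemma branching_scheme_step:
  assumes F: "finite F" "\<forall>U\<in>F. openin Y.mtopology U \<and> U \<noteq> {}" and e: "0 < e"
    and B: "\<And>i. openin Y.mtopology (B i) \<and> B i \<noteq> {}"
  shows "\<exists>F' e'. finite F' \<and> (\<forall>U\<in>F'. openin Y.mtopology U \<and> U \<noteq> {}) \<and> 0 < e' \<and> 8 * e' \<le> e \<and>
    (\<forall>U\<in>F. splits k e e' U F') \<and>
    (\<forall>i\<le>k. \<exists>W\<in>F'. W \<subseteq> B i \<and> (\<forall>x\<in>W. \<forall>y\<in>W. d (h x) (h y) \<le> e' / 4))"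
proof -
  have "\<forall>U\<in>F. \<exists>c \<W>. 0 < c \<and> finite \<W> \<and> (\<forall>W\<in>\<W>. openin Y.mtopology W \<and> W \<noteq> {}) \<and> splits k e c U \<W>"
    by (intro ballI splits_exists) (use F e in auto)
  then obtain c \<W> where c: "\<And>U. U \<in> F \<Longrightarrow> 0 < c U"
    and \<W>: "\<And>U. U \<in> F \<Longrightarrow> finite (\<W> U)"
      "\<And>U W. U \<in> F \<Longrightarrow> W \<in> \<W> U \<Longrightarrow> openin Y.mtopology W \<and> W \<noteq> {}"
    and splits: "\<And>U. U \<in> F \<Longrightarrow> splits k e (c U) U (\<W> U)"
    by metis
  define e' where "e' = Min (insert (e / 8) (c ` F))"
  have "e' \<le> e / 8"
    unfolding e'_def using F by (intro Min_le) auto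
  then have e': "0 < e'" "8 * e' \<le> e"
    using F e c by (auto simp: e'_def)
  have e'_le: "e' \<le> c U" if "U \<in> F" for U
    using F that by (simp add: e'_def)
  have "\<forall>i. \<exists>V. openin Y.mtopology V \<and> V \<noteq> {} \<and> V \<subseteq> B i \<and> (\<forall>x\<in>V. \<forall>y\<in>V. d (h x) (h y) \<le> e' / 4)"
    by (intro allI shrink) (use B e' in auto)
  then obtain V where V: "\<And>i. openin Y.mtopology (V i) \<and> V i \<noteq> {} \<and> V i \<subseteq> B i"
    and close: "\<And>i. \<forall>x\<in>V i. \<forall>y\<in>V i. d (h x) (h y) \<le> e' / 4"
    by metis
  show ?thesis
  proof (intro exI conjI ballI allI impI)
    let ?F = "(\<Union>U\<in>F. \<W> U) \<union> V ` {..k}"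
    show "finite ?F"
      using F \<W> by auto
    show "openin Y.mtopology U" "U \<noteq> {}" if "U \<in> ?F" for U
    proof -
      consider U' where "U' \<in> F" "U \<in> \<W> U'" | i where "U = V i"
        using \<open>U \<in> ?F\<close> by blast
      then have "openin Y.mtopology U \<and> U \<noteq> {}"
        by cases (use \<W>(2) V in simp_all)
      then show "openin Y.mtopology U" "U \<noteq> {}"
        by simp_all
    qed
    show "splits k e e' U ?F" if "U \<in> F" for U
      by (rule splits_mono [OF splits [OF that] e'_le [OF that]]) (use that in auto)
    show "\<exists>W\<in>?F. W \<subseteq> B i \<and> (\<forall>x\<in>W. \<forall>y\<in>W. d (h x) (h y) \<le> e' / 4)" if "i \<le> k" for i
      using that V close by (intro bexI [of _ "V i"]) auto
  qed (use e' in auto)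
qed

text \<open>
  One sequence of scales \<open>e\<close> serves two purposes: stage \<open>k\<close> works with a net of mesh \<open>e k\<close> and
  thickens its points by \<open>e (Suc k)\<close>. Every member of the family \<open>F k\<close> splits into two members of
  the next family, whose images are separated at the thickening scale. The last clause makes the
  families a \<open>\<pi>\<close>-base; the set it provides appears in stage \<open>Suc j\<close> with an image that is small even
  at the scale \<open>e (Suc j)\<close>, which bounds from below all thickenings used in the stages up to \<open>j\<close>.
\<close>

definition branching_scheme :: "(nat \<Rightarrow> 'y set set) \<Rightarrow> (nat \<Rightarrow> real) \<Rightarrow> bool" where
  "branching_scheme F e \<longleftrightarrow>
     Y \<in> F 0 \<and> (\<forall>k. 0 < e k \<and> 8 * e (Suc k) \<le> e k) \<and>
     (\<forall>k. \<forall>U \<in> F k. openin Y.mtopology U \<and> U \<noteq> {} \<and> splits k (e k) (e (Suc k)) U (F (Suc k))) \<and>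
     (\<forall>k U. openin Y.mtopology U \<longrightarrow> U \<noteq> {} \<longrightarrow>
        (\<exists>j\<ge>k. \<exists>W\<in>F (Suc j). W \<subseteq> U \<and> (\<forall>x\<in>W. \<forall>y\<in>W. d (h x) (h y) \<le> e (Suc j) / 4)))"

lemma branching_schemeD:
  assumes "branching_scheme F e"
  shows "Y \<in> F 0" "0 < e k" "8 * e (Suc k) \<le> e k"
    "U \<in> F k \<Longrightarrow> openin Y.mtopology U \<and> U \<noteq> {}"
    "U \<in> F k \<Longrightarrow> splits k (e k) (e (Suc k)) U (F (Suc k))"
    "\<lbrakk>openin Y.mtopology U; U \<noteq> {}\<rbrakk> \<Longrightarrow>
       \<exists>j\<ge>k. \<exists>W\<in>F (Suc j). W \<subseteq> U \<and> (\<forall>x\<in>W. \<forall>y\<in>W. d (h x) (h y) \<le> e (Suc j) / 4)"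
proof -
  note parts = assms [unfolded branching_scheme_def]
  show "Y \<in> F 0"
    using parts [THEN conjunct1] .
  show "0 < e k" "8 * e (Suc k) \<le> e k"
    using parts [THEN conjunct2, THEN conjunct1] by simp_all
  show "openin Y.mtopology U \<and> U \<noteq> {}" "splits k (e k) (e (Suc k)) U (F (Suc k))" if "U \<in> F k"
    using parts [THEN conjunct2, THEN conjunct2, THEN conjunct1] that by simp_all
  show "\<exists>j\<ge>k. \<exists>W\<in>F (Suc j). W \<subseteq> U \<and> (\<forall>x\<in>W. \<forall>y\<in>W. d (h x) (h y) \<le> e (Suc j) / 4)"
    if "openin Y.mtopology U" "U \<noteq> {}"
    by (rule parts [THEN conjunct2, THEN conjunct2, THEN conjunct2, rule_format, OF that])
qed

lemma branching_scheme_exists: "\<exists>F e. branching_scheme F e"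
proof -
  obtain \<B> where \<B>: "countable \<B>" "\<forall>V\<in>\<B>. openin Y.mtopology V"
      "\<forall>U x. openin Y.mtopology U \<and> x \<in> U \<longrightarrow> (\<exists>V\<in>\<B>. x \<in> V \<and> V \<subseteq> U)"
    using countable_base unfolding second_countable_def by blast
  have base: "\<exists>V\<in>\<B> - {{}}. V \<subseteq> U" if "openin Y.mtopology U" "U \<noteq> {}" for U
  proof -
    obtain x where "x \<in> U"
      using \<open>U \<noteq> {}\<close> by blast
    then show ?thesis
      using \<B>(3) \<open>openin Y.mtopology U\<close> by blast
  qed
  then have "\<B> - {{}} \<noteq> {}"
    using nonempty by blast
  define B where "B = from_nat_into (\<B> - {{}})"
  have range_B: "range B = \<B> - {{}}"
    unfolding B_def using \<B>(1) \<open>\<B> - {{}} \<noteq> {}\<close> by (intro range_from_nat_into) auto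
  then have B: "openin Y.mtopology (B i) \<and> B i \<noteq> {}" for i
    using \<B>(2) by (metis DiffE insertI1 rangeI)
  define good where
    "good n s \<longleftrightarrow> finite (fst s) \<and> (\<forall>U\<in>fst s. openin Y.mtopology U \<and> U \<noteq> {}) \<and> 0 < snd s \<and>
       (n = 0 \<longrightarrow> Y \<in> fst s)" for n :: nat and s :: "'y set set \<times> real"
  define refines where
    "refines k s s' \<longleftrightarrow> 8 * snd s' \<le> snd s \<and> (\<forall>U\<in>fst s. splits k (snd s) (snd s') U (fst s')) \<and>
       (\<forall>i\<le>k. \<exists>W\<in>fst s'. W \<subseteq> B i \<and> (\<forall>x\<in>W. \<forall>y\<in>W. d (h x) (h y) \<le> snd s' / 4))"
    for k and s s' :: "'y set set \<times> real"
  have "\<exists>s. \<forall>n. good n (s n) \<and> refines n (s n) (s (Suc n))"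
  proof (rule dependent_nat_choice)
    show "\<exists>s. good 0 s"
      by (rule exI [of _ "({Y}, 1)"]) (simp add: good_def nonempty)
    show "\<exists>s'. good (Suc n) s' \<and> refines n s s'" if "good n s" for s n
    proof -
      have s: "finite (fst s)" "\<forall>U\<in>fst s. openin Y.mtopology U \<and> U \<noteq> {}" "0 < snd s"
        using that unfolding good_def by blast+
      show ?thesis
        using branching_scheme_step [OF s B, of n]
        unfolding good_def refines_def split_paired_Ex fst_conv snd_conv by simp
    qed
  qed
  then obtain s where good: "\<And>n. good n (s n)" and refines: "\<And>n. refines n (s n) (s (Suc n))"
    by blast
  have "branching_scheme (\<lambda>n. fst (s n)) (\<lambda>n. snd (s n))"
    unfolding branching_scheme_def
  proof (intro conjI allI ballI impI)
    show "Y \<in> fst (s 0)"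
      using good [of 0] unfolding good_def by blast
    show "0 < snd (s k)" for k
      using good [of k] unfolding good_def by blast
    show "8 * snd (s (Suc k)) \<le> snd (s k)" for k
      using refines [of k] unfolding refines_def by blast
    show "openin Y.mtopology U" "U \<noteq> {}" if "U \<in> fst (s k)" for k U
      using good [of k] that unfolding good_def by blast+
    show "splits k (snd (s k)) (snd (s (Suc k))) U (fst (s (Suc k)))" if "U \<in> fst (s k)" for k U
      using refines [of k] that unfolding refines_def by blast
    show "\<exists>j\<ge>k. \<exists>W\<in>fst (s (Suc j)). W \<subseteq> U \<and> (\<forall>x\<in>W. \<forall>y\<in>W. d (h x) (h y) \<le> snd (s (Suc j)) / 4)"
      if U: "openin Y.mtopology U" "U \<noteq> {}" for k U
    proof -
      obtain i where i: "B i \<subseteq> U"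
        using base [OF U] range_B by (metis rangeE)
      have "\<exists>W\<in>fst (s (Suc (max i k))). W \<subseteq> B i \<and>
          (\<forall>x\<in>W. \<forall>y\<in>W. d (h x) (h y) \<le> snd (s (Suc (max i k))) / 4)"
        using refines [of "max i k"] unfolding refines_def by simp
      then show ?thesis
        using i by (intro exI [of _ "max i k"]) auto
    qed
  qed
  then show ?thesis
    by blast
qed

section \<open>A nowhere dense set with large products\<close>

text \<open>
  Both invariances of the metric enter here. If quotients taken from both halves were near the net,
  at points \<open>p\<close> and \<open>q\<close>, then \<open>p \<otimes> h x\<close> and \<open>q \<otimes> h y\<close> would both be near \<open>z\<close>. As
  \<open>h x\<close> and \<open>h y\<close> are close at scale \<open>e\<close>, the net being separated forces \<open>p = q\<close>, and then
  \<open>h x\<close> and \<open>h y\<close> are close at scale \<open>c\<close> as well, contrary to the splitting.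
\<close>

lemma avoid_net:
  assumes splits: "splits k e c U \<W>" and z: "z \<in> carrier G"
    and R: "separated_net e R"
    and c: "0 < c" "8 * c \<le> e"
  shows "\<exists>a r. 0 < r \<and> r \<le> (1/2)^k \<and> a \<in> Y \<and> Y.mcball a r \<subseteq> U \<and> Y.mball a r \<in> \<W> \<and>
    (\<forall>y \<in> Y.mball a r. \<forall>q\<in>R. 2 * c < d (z \<otimes> inv (h y)) q)"
proof -
  obtain a b r where r: "0 < r" "r \<le> (1/2)^k"
    and a: "a \<in> Y" "Y.mcball a r \<subseteq> U" "Y.mball a r \<in> \<W>"
    and b: "b \<in> Y" "Y.mcball b r \<subseteq> U" "Y.mball b r \<in> \<W>"
    and apart: "\<forall>x \<in> Y.mball a r. \<forall>y \<in> Y.mball b r. d (h x) (h y) \<le> e / 4 \<and> 4 * c < d (h x) (h y)"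
    using splits unfolding splits_def by blast
  have "(\<forall>y \<in> Y.mball a r. \<forall>q\<in>R. 2 * c < d (z \<otimes> inv (h y)) q) \<or>
      (\<forall>y \<in> Y.mball b r. \<forall>q\<in>R. 2 * c < d (z \<otimes> inv (h y)) q)"
  proof (rule ccontr)
    assume "\<not> ?thesis"
    then obtain x p y q where x: "x \<in> Y.mball a r" "p \<in> R" "d (z \<otimes> inv (h x)) p \<le> 2 * c"
      and y: "y \<in> Y.mball b r" "q \<in> R" "d (z \<otimes> inv (h y)) q \<le> 2 * c"
      by (auto simp: not_less simp del: Y.in_mball)
    have xy: "x \<in> Y" "y \<in> Y" "p \<in> carrier G" "q \<in> carrier G"
      using x y R unfolding separated_net_def by auto
    have gap: "d (h x) (h y) \<le> e / 4" "4 * c < d (h x) (h y)"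
      using apart x(1) y(1) by blast+
    have zp: "d z (p \<otimes> h x) \<le> 2 * c" and zq: "d z (q \<otimes> h y) \<le> 2 * c"
      using x(3) y(3) z xy by (simp_all add: dist_divide)
    have near: "d (p \<otimes> h x) (q \<otimes> h y) \<le> 4 * c"
      using triangle'' [of "p \<otimes> h x" z "q \<otimes> h y"] zp zq z xy by simp
    have "d p q = d (p \<otimes> h x) (q \<otimes> h x)"
      using xy by (simp add: right_invariant)
    also have "\<dots> \<le> d (p \<otimes> h x) (q \<otimes> h y) + d (q \<otimes> h x) (q \<otimes> h y)"
      using xy by (intro triangle') auto
    also have "\<dots> = d (p \<otimes> h x) (q \<otimes> h y) + d (h x) (h y)"
      using xy by (simp add: left_invariant)
    also have "\<dots> < e"
      using near gap c by linarith
    finally have "p = q"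
      using R x(2) y(2) unfolding separated_net_def by blast
    then have "d (h x) (h y) \<le> 4 * c"
      using near xy by (simp add: left_invariant)
    then show False
      using gap by simp
  qed
  then show ?thesis
    using r a b by blast
qed

text \<open>
  Choosing the good half at every stage yields nested balls, and completeness gives a point \<open>y\<close> in
  all of them.
\<close>

lemma avoid_all_nets:
  assumes scheme: "branching_scheme F e"
    and R: "\<And>k. separated_net (e k) (R k)"
    and U: "U \<in> F k" and z: "z \<in> carrier G"
  shows "\<exists>y\<in>U. \<forall>i\<ge>k. \<forall>q \<in> R i. 2 * e (Suc i) < d (z \<otimes> inv (h y)) q"
proof -
  note splits = branching_schemeD(5) [OF scheme] and e = branching_schemeD(2,3) [OF scheme]
  define good where
    "good n s \<longleftrightarrow> 0 < snd s \<and> snd s \<le> (1/2)^(k + n) \<and> fst s \<in> Y \<and>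
       Y.mcball (fst s) (snd s) \<subseteq> U \<and> Y.mball (fst s) (snd s) \<in> F (Suc (k + n)) \<and>
       (\<forall>y \<in> Y.mball (fst s) (snd s). \<forall>q \<in> R (k + n). 2 * e (Suc (k + n)) < d (z \<otimes> inv (h y)) q)"
    for n :: nat and s :: "'y \<times> real"
  define inside where
    "inside s s' \<longleftrightarrow> Y.mcball (fst s') (snd s') \<subseteq> Y.mball (fst s) (snd s)" for s s' :: "'y \<times> real"
  have step: "\<exists>a r. 0 < r \<and> r \<le> (1/2)^i \<and> a \<in> Y \<and> Y.mcball a r \<subseteq> V \<and> Y.mball a r \<in> F (Suc i) \<and>
      (\<forall>y \<in> Y.mball a r. \<forall>q \<in> R i. 2 * e (Suc i) < d (z \<otimes> inv (h y)) q)" if "V \<in> F i" for V i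
    by (rule avoid_net [OF splits [OF that] z R e(1) e(2)])
  have "\<exists>s. \<forall>n. good n (s n) \<and> inside (s n) (s (Suc n))"
  proof (rule dependent_nat_choice)
    show "\<exists>s. good 0 s"
      using step [OF U] unfolding good_def by auto
    show "\<exists>s'. good (Suc n) s' \<and> inside s s'" if s: "good n s" for s n
    proof -
      have sF: "Y.mball (fst s) (snd s) \<in> F (Suc (k + n))" and sU: "Y.mcball (fst s) (snd s) \<subseteq> U"
        using s unfolding good_def by blast+
      obtain a r where "0 < r" "r \<le> (1/2)^Suc (k + n)" "a \<in> Y"
          "Y.mcball a r \<subseteq> Y.mball (fst s) (snd s)" "Y.mball a r \<in> F (Suc (Suc (k + n)))"
          "\<forall>y \<in> Y.mball a r. \<forall>q \<in> R (Suc (k + n)). 2 * e (Suc (Suc (k + n))) < d (z \<otimes> inv (h y)) q"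
        using step [OF sF] by blast
      moreover from this have "Y.mcball a r \<subseteq> U"
        using sU Y.mball_subset_mcball by blast
      ultimately show ?thesis
        unfolding good_def inside_def by (intro exI [of _ "(a, r)"]) simp
    qed
  qed
  then obtain s where good: "\<And>n. good n (s n)" and inside: "\<And>n. inside (s n) (s (Suc n))"
    by blast
  define C where "C n = Y.mcball (fst (s n)) (snd (s n))" for n
  have C_Suc: "C (Suc n) \<subseteq> Y.mball (fst (s n)) (snd (s n))" for n
    using inside [of n] unfolding inside_def C_def .
  have "decseq C"
    unfolding decseq_Suc_iff using C_Suc Y.mball_subset_mcball unfolding C_def by blast
  moreover have "\<forall>n. closedin Y.mtopology (C n)"
    unfolding C_def by simp
  moreover have "\<forall>n. C n \<noteq> {}"
    using good unfolding C_def good_def by (simp add: Y.mcball_eq_empty not_less less_imp_le)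
  moreover have "\<forall>\<epsilon>>0. \<exists>n a. C n \<subseteq> Y.mcball a \<epsilon>"
  proof (intro allI impI)
    fix \<epsilon> :: real
    assume "0 < \<epsilon>"
    then obtain n where n: "(1/2)^n < \<epsilon>"
      using real_arch_pow_inv [of \<epsilon> "1/2"] by auto
    have "snd (s n) \<le> (1/2)^(k + n)"
      using good unfolding good_def by blast
    also have "\<dots> \<le> (1/2)^n"
      by (rule power_decreasing) auto
    finally have "C n \<subseteq> Y.mcball (fst (s n)) \<epsilon>"
      unfolding C_def using n by (intro Y.mcball_subset_concentric) linarith
    then show "\<exists>n a. C n \<subseteq> Y.mcball a \<epsilon>"
      by blast
  qed
  ultimately have "\<Inter> (range C) \<noteq> {}"
    using complete unfolding Y.mcomplete_nest by blast
  then obtain y where y: "\<And>n. y \<in> C n"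
    by blast
  have "2 * e (Suc i) < d (z \<otimes> inv (h y)) q" if "k \<le> i" "q \<in> R i" for i q
  proof -
    have "y \<in> Y.mball (fst (s (i - k))) (snd (s (i - k)))"
      using y C_Suc by blast
    then show ?thesis
      using good [of "i - k"] that unfolding good_def by simp
  qed
  moreover have "y \<in> U"
    using y [of 0] good [of 0] unfolding C_def good_def by blast
  ultimately show ?thesis
    by blast
qed

text \<open>
  The set \<open>N\<close> is the closure of the set \<open>D\<close> of points that stay further than \<open>e (Suc k)\<close> from the
  \<open>k\<close>-th net for every \<open>k\<close>, with an excess of \<open>e (Suc k)\<close> for all large \<open>k\<close> and a uniform positive
  excess for the others. Removing a ball around each point of finer and finer nets makes \<open>N\<close>
  nowhere dense. It is nevertheless large as seen through \<open>h\<close>: if \<open>w \<in> D\<close> and \<open>W \<subseteq> U\<close> is a member of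
  the scheme with small image, then for every \<open>z\<close> near \<open>w \<otimes> h x\<close> all quotients \<open>z \<otimes> inv (h y)\<close> with
  \<open>y \<in> W\<close> are near \<open>w\<close>, hence away from the nets of the early stages, and a suitable \<open>y\<close> keeps the
  quotient away from all later nets too. So the products fill a ball.
\<close>

theorem thick_nowhere_dense_set:
  "\<exists>N. closedin mtopology N \<and> nowhere_dense_in mtopology N \<and> N \<noteq> {} \<and>
     (\<forall>V U. openin mtopology V \<and> V \<inter> N \<noteq> {} \<and> openin Y.mtopology U \<and> U \<noteq> {} \<longrightarrow>
        mtopology interior_of ((V \<inter> N) <#> h ` U) \<noteq> {})"
proof -
  obtain F e where scheme: "branching_scheme F e"
    using branching_scheme_exists by blast
  note YF = branching_schemeD(1) [OF scheme] and e = branching_schemeD(2,3) [OF scheme]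
    and F_open = branching_schemeD(4) [OF scheme] and catch = branching_schemeD(6) [OF scheme]
  have "\<forall>k. \<exists>R. separated_net (e k) R"
    by (intro allI separated_net_exists e)
  then obtain R where R: "\<And>k. separated_net (e k) (R k)"
    by metis
  have R_sub: "R k \<subseteq> carrier G" for k
    using R [of k] unfolding separated_net_def by blast
  have avoid: "\<exists>y\<in>U. \<forall>i\<ge>k. \<forall>q \<in> R i. 2 * e (Suc i) < d (z \<otimes> inv (h y)) q"
    if "U \<in> F k" "z \<in> carrier G" for U k z
    by (rule avoid_all_nets [OF scheme R that])
  have e_mono: "e j \<le> e i" if "i \<le> j" for i j
  proof (rule lift_Suc_antimono_le [OF _ that])
    show "e (Suc n) \<le> e n" for n
      using e(1) [of "Suc n"] e(2) [of n] by linarith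
  qed
  have e_small: "\<exists>k. \<forall>j\<ge>k. e j < s" if "0 < s" for s
  proof -
    have bound: "e k \<le> e 0 * (1/2)^k" for k
    proof (induction k)
      case (Suc k)
      then show ?case
        using e(1) [of "Suc k"] e(2) [of k] by simp
    qed simp
    have "0 < s / e 0"
      using that e(1) by simp
    then obtain k where "(1/2)^k < s / e 0"
      using real_arch_pow_inv [of "s / e 0" "1/2"] by auto
    then have "e 0 * (1/2)^k < s"
      using e(1) [of 0] by (simp add: field_simps)
    then show ?thesis
      using bound [of k] e_mono [of k] by force
  qed
  \<comment> \<open>The minimum encodes the two kinds of excess: it is \<open>t\<close> for the finitely many \<open>k\<close> with
    \<open>t < e (Suc k)\<close> and \<open>e (Suc k)\<close> for all others.\<close>
  define D where
    "D = {w \<in> carrier G. \<exists>t>0. \<forall>k. \<forall>q \<in> R k. e (Suc k) + min (e (Suc k)) t < d w q}"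
  define N where "N = mtopology closure_of D"
  have D_sub: "D \<subseteq> N"
    unfolding N_def by (rule closure_of_subset) (auto simp: D_def)
  show ?thesis
  proof (intro exI conjI allI impI)
    show "closedin mtopology N"
      unfolding N_def by simp
    then have closure_N: "mtopology closure_of N = N"
      by (rule closure_of_closedin)
    have "mtopology interior_of N = {}"
    proof (rule ccontr)
      assume "mtopology interior_of N \<noteq> {}"
      then obtain x where "x \<in> mtopology interior_of N"
        by blast
      then obtain s where s: "0 < s" "mball x s \<subseteq> N" and x: "x \<in> carrier G"
        unfolding metric_interior_of by blast
      obtain k where k: "e k < s"
        using e_small [OF s(1)] by blast
      obtain q where q: "q \<in> R k" "d x q < e k"
        using R [of k] x unfolding separated_net_def by blast
      have qG: "q \<in> carrier G"
        using q R_sub by blast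
      have "q \<in> mball x s"
        using q qG k x by simp
      then have "q \<in> mtopology closure_of D"
        using s N_def by blast
      then obtain w where w: "w \<in> D" "w \<in> mball q (e (Suc k))"
        using e(1) [of "Suc k"] unfolding metric_closure_of by blast
      obtain t where t: "0 < t" "\<forall>k. \<forall>q \<in> R k. e (Suc k) + min (e (Suc k)) t < d w q"
        using w unfolding D_def by blast
      have "e (Suc k) < d w q"
        using t(2) [rule_format, OF q(1)] t(1) e(1) [of "Suc k"] by linarith
      then show False
        using w(2) by (simp add: commute)
    qed
    then show "nowhere_dense_in mtopology N"
      unfolding nowhere_dense_in_def closure_N
      using \<open>closedin mtopology N\<close> closedin_subset by fastforce
    show "N \<noteq> {}"
    proof -
      obtain y where y: "y \<in> Y" "\<forall>i\<ge>0. \<forall>q \<in> R i. 2 * e (Suc i) < d (\<one> \<otimes> inv (h y)) q"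
        using avoid [OF YF one_closed] by blast
      have "\<forall>k. \<forall>q \<in> R k. e (Suc k) + min (e (Suc k)) 1 < d (\<one> \<otimes> inv (h y)) q"
      proof (intro allI ballI)
        fix k q
        assume "q \<in> R k"
        then have "2 * e (Suc k) < d (\<one> \<otimes> inv (h y)) q"
          using y by blast
        then show "e (Suc k) + min (e (Suc k)) 1 < d (\<one> \<otimes> inv (h y)) q"
          by linarith
      qed
      moreover have "\<one> \<otimes> inv (h y) \<in> carrier G"
        using y(1) by simp
      ultimately have "\<one> \<otimes> inv (h y) \<in> D"
        unfolding D_def using zero_less_one by blast
      then show ?thesis
        using D_sub by blast
    qed
    show "mtopology interior_of ((V \<inter> N) <#> h ` U) \<noteq> {}"
      if VU: "openin mtopology V \<and> V \<inter> N \<noteq> {} \<and> openin Y.mtopology U \<and> U \<noteq> {}" for V U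
    proof -
      from VU have V: "openin mtopology V" "V \<inter> N \<noteq> {}" and U: "openin Y.mtopology U" "U \<noteq> {}"
        by blast+
      obtain w where w: "w \<in> V" "w \<in> D"
        using V openin_Int_closure_of_eq_empty [OF V(1), of D] unfolding N_def by blast
      obtain t where t: "0 < t" "\<forall>k. \<forall>q \<in> R k. e (Suc k) + min (e (Suc k)) t < d w q"
        and wG: "w \<in> carrier G"
        using w(2) unfolding D_def by blast
      obtain s where s: "0 < s" "mball w s \<subseteq> V"
        using V(1) w(1) unfolding openin_mtopology by blast
      \<comment> \<open>Below \<open>s\<close> so that the quotients stay in \<open>V\<close>, below \<open>t\<close> so that they inherit the excess of \<open>w\<close>.\<close>
      obtain n where n: "\<forall>j\<ge>n. e j < min s t"
        using e_small [of "min s t"] s t by auto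
      obtain j W where j: "n \<le> j" and W: "W \<in> F (Suc j)" "W \<subseteq> U"
          "\<forall>x\<in>W. \<forall>y\<in>W. d (h x) (h y) \<le> e (Suc j) / 4"
        using catch [OF U, of n] by blast
      define \<epsilon> where "\<epsilon> = e (Suc j)"
      have \<epsilon>: "0 < \<epsilon>" "\<epsilon> < s" "\<epsilon> < t"
        using n j e(1) unfolding \<epsilon>_def by (auto simp: le_SucI)
      obtain x where x: "x \<in> W"
        using F_open [OF W(1)] by blast
      have WY: "W \<subseteq> Y"
        using F_open [OF W(1)] openin_Y_subset by blast
      then have xG: "h x \<in> carrier G"
        using x by auto
      have "mball (w \<otimes> h x) (\<epsilon> / 4) \<subseteq> (V \<inter> N) <#> h ` U"
      proof
        fix z
        assume "z \<in> mball (w \<otimes> h x) (\<epsilon> / 4)"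
        then have z: "z \<in> carrier G" "d (w \<otimes> h x) z < \<epsilon> / 4"
          by auto
        obtain y where y: "y \<in> W" "\<forall>i\<ge>Suc j. \<forall>q \<in> R i. 2 * e (Suc i) < d (z \<otimes> inv (h y)) q"
          using avoid [OF W(1) z(1)] by blast
        have yG: "h y \<in> carrier G"
          using y(1) WY by auto
        define m where "m = z \<otimes> inv (h y)"
        have mG: "m \<in> carrier G"
          unfolding m_def using z yG by simp
        have "d m w = d z (w \<otimes> h y)"
          unfolding m_def using z wG yG by (simp add: dist_divide)
        also have "\<dots> \<le> d (w \<otimes> h x) z + d (w \<otimes> h x) (w \<otimes> h y)"
          using z wG xG yG by (intro triangle'') auto
        also have "\<dots> = d (w \<otimes> h x) z + d (h x) (h y)"
          using wG xG yG by (simp add: left_invariant)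
        also have "\<dots> < \<epsilon> / 2"
        proof -
          have "d (h x) (h y) \<le> \<epsilon> / 4"
            using W(3) x y(1) unfolding \<epsilon>_def by blast
          then show ?thesis
            using z(2) by linarith
        qed
        finally have mw: "d m w < \<epsilon> / 2" .
        \<comment> \<open>The witness for \<open>m \<in> D\<close> is \<open>\<epsilon> / 2\<close>: up to stage \<open>j\<close> the point \<open>w\<close> has excess at least \<open>\<epsilon>\<close>, of
          which moving to \<open>m\<close> costs less than half; afterwards the choice of \<open>y\<close> gives excess \<open>e (Suc k)\<close>.\<close>
        have "e (Suc k) + min (e (Suc k)) (\<epsilon> / 2) < d m q" if q: "q \<in> R k" for k q
        proof (cases "k \<le> j")
          case True
          have "\<epsilon> \<le> e (Suc k)"
            unfolding \<epsilon>_def using True by (intro e_mono) simp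
          then have "e (Suc k) + \<epsilon> < d w q"
            using t(2) [rule_format, OF q] \<epsilon> by linarith
          moreover have "d w q \<le> d m w + d m q"
            using mG wG q R_sub by (intro triangle'') auto
          ultimately show ?thesis
            using mw by linarith
        next
          case False
          then have "2 * e (Suc k) < d m q"
            using y(2) q unfolding m_def by simp
          then show ?thesis
            by linarith
        qed
        then have "m \<in> D"
          unfolding D_def using mG half_gt_zero [OF \<epsilon>(1)] by blast
        moreover have "m \<in> V"
        proof -
          have "m \<in> mball w s"
            using mw \<epsilon> mG wG by (simp add: commute)
          then show ?thesis
            using s by blast
        qed
        moreover have "z = m \<otimes> h y"
          unfolding m_def using z yG by (simp add: m_assoc)
        ultimately show "z \<in> (V \<inter> N) <#> h ` U"
          unfolding set_mult_def using D_sub y(1) W(2) by blast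
      qed
      then have "w \<otimes> h x \<in> mtopology interior_of ((V \<inter> N) <#> h ` U)"
        unfolding in_interior_of_mball using \<epsilon>(1) wG xG by (intro conjI exI [of _ "\<epsilon> / 4"]) simp_all
      then show ?thesis
        by blast
    qed
  qed
qed

section \<open>Preimages of meager-additive sets\<close>

text \<open>
  Translating the meager-additive set by the thick nowhere dense set \<open>N\<close> gives a meager set, covered
  by closed sets \<open>E n\<close> without interior. For \<open>y \<in> P\<close> the closed set \<open>N\<close> is the union of its parts
  \<open>{m \<in> N. m \<otimes> h y \<in> E n}\<close>, so by Baire's theorem one of them contains a basic open piece of \<open>N\<close>.
  Sorting the points \<open>y\<close> by the index \<open>n\<close> and the piece gives countably many closed sets \<open>C n V\<close>; an
  open \<open>U\<close> inside one of them would put the products of the piece with \<open>h ` U\<close> into \<open>E n\<close>, against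
  thickness.
\<close>

lemma closed_cover_of_preimage:
  assumes G: "completely_metrizable_space mtopology" "second_countable mtopology"
    and A: "meager_additive G mtopology A"
    and P: "P \<subseteq> Y" "h ` P \<subseteq> A"
  shows "\<exists>\<C>. countable \<C> \<and> P \<subseteq> \<Union>\<C> \<and>
    (\<forall>C\<in>\<C>. closedin Y.mtopology C \<and> Y.mtopology interior_of C = {})"
proof -
  obtain N where N: "closedin mtopology N" "nowhere_dense_in mtopology N" "N \<noteq> {}"
    and thick: "\<forall>V U. openin mtopology V \<and> V \<inter> N \<noteq> {} \<and> openin Y.mtopology U \<and> U \<noteq> {} \<longrightarrow>
        mtopology interior_of ((V \<inter> N) <#> h ` U) \<noteq> {}"
    using thick_nowhere_dense_set by blast
  have NG: "N \<subseteq> carrier G"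
    using closedin_subset [OF N(1)] by simp
  have "meager_in mtopology N"
    unfolding meager_in_def using N(2) by (intro exI [of _ "\<lambda>_. N"]) simp
  then have "meager_in mtopology (N <#> A)"
    using A unfolding meager_additive_def by blast
  then obtain S :: "nat \<Rightarrow> 'a set" where S: "\<And>n. nowhere_dense_in mtopology (S n)"
    and NA: "N <#> A = (\<Union>n. S n)"
    unfolding meager_in_def by blast
  define E where "E n = mtopology closure_of (S n)" for n
  have E: "closedin mtopology (E n)" "mtopology interior_of (E n) = {}" "S n \<subseteq> E n" for n
    using S [of n] unfolding E_def nowhere_dense_in_def by (simp_all add: closure_of_subset)
  obtain \<B> where \<B>: "countable \<B>" "\<forall>V\<in>\<B>. openin mtopology V"
      "\<forall>U x. openin mtopology U \<and> x \<in> U \<longrightarrow> (\<exists>V\<in>\<B>. x \<in> V \<and> V \<subseteq> U)"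
    using G(2) unfolding second_countable_def by blast
  define C where "C n V = {y \<in> Y. \<forall>m \<in> V \<inter> N. m \<otimes> h y \<in> E n}" for n V
  define \<C> where "\<C> = (\<lambda>(n, V). C n V) ` (UNIV \<times> {V \<in> \<B>. V \<inter> N \<noteq> {}})"
  have "countable \<C>"
    unfolding \<C>_def using \<B>(1) by (intro countable_image countable_SIGMA) auto
  moreover have "closedin Y.mtopology (C n V)" if "V \<inter> N \<noteq> {}" for n V
  proof -
    have "C n V = (\<Inter>m \<in> V \<inter> N. {y \<in> topspace Y.mtopology. m \<otimes> h y \<in> E n})"
      using that unfolding C_def by auto
    also have "closedin Y.mtopology \<dots>"
    proof (intro closedin_Inter)
      fix K
      assume "K \<in> (\<lambda>m. {y \<in> topspace Y.mtopology. m \<otimes> h y \<in> E n}) ` (V \<inter> N)"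
      then obtain m where m: "m \<in> N" and K: "K = {y \<in> topspace Y.mtopology. m \<otimes> h y \<in> E n}"
        by blast
      have "continuous_map Y.mtopology mtopology ((\<lambda>x. m \<otimes> x) \<circ> h)"
        using continuous continuous_left_translation m NG by (intro continuous_map_compose) auto
      then show "closedin Y.mtopology K"
        unfolding K using closedin_continuous_map_preimage [OF _ E(1)] by fastforce
    qed (use that in auto)
    finally show ?thesis .
  qed
  moreover have "Y.mtopology interior_of (C n V) = {}" if "V \<in> \<B>" "V \<inter> N \<noteq> {}" for n V
  proof (rule ccontr)
    let ?U = "Y.mtopology interior_of (C n V)"
    assume "?U \<noteq> {}"
    then have "mtopology interior_of ((V \<inter> N) <#> h ` ?U) \<noteq> {}"
      using thick \<B>(2) that by (meson openin_interior_of)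
    moreover have "(V \<inter> N) <#> h ` ?U \<subseteq> E n"
      using interior_of_subset [of Y.mtopology "C n V"] unfolding C_def set_mult_def by blast
    ultimately show False
      using E(2) [of n] interior_of_mono by blast
  qed
  moreover have "P \<subseteq> \<Union>\<C>"
  proof
    fix y
    assume y: "y \<in> P"
    have hy: "h y \<in> carrier G" "h y \<in> A"
      using y P by auto
    define K where "K n = {m \<in> topspace (subtopology mtopology N). m \<otimes> h y \<in> E n}" for n
    have top_N: "topspace (subtopology mtopology N) = N"
      using NG by auto
    have K: "closedin (subtopology mtopology N) (K n)" for n
      unfolding K_def
      by (intro closedin_continuous_map_preimage [OF _ E(1)] continuous_map_from_subtopology
          continuous_right_translation hy)
    have "N \<subseteq> (\<Union>n. K n)"
    proof
      fix m
      assume "m \<in> N"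
      then have "m \<otimes> h y \<in> N <#> A"
        using hy unfolding set_mult_def by blast
      then obtain n where "m \<otimes> h y \<in> S n"
        using NA by blast
      then show "m \<in> (\<Union>n. K n)"
        using E(3) \<open>m \<in> N\<close> top_N unfolding K_def by blast
    qed
    then have union: "\<Union> (range K) = topspace (subtopology mtopology N)"
      unfolding K_def top_N by blast
    have "completely_metrizable_space (subtopology mtopology N)"
      by (rule completely_metrizable_space_closedin [OF G(1) N(1)])
    then have "subtopology mtopology N interior_of \<Union> (range K) = {}"
      if "\<forall>n. subtopology mtopology N interior_of K n = {}"
      using K that by (intro Baire_category_alt) auto
    then have "\<exists>n. subtopology mtopology N interior_of K n \<noteq> {}"
      unfolding union interior_of_topspace using top_N N(3) by metis
    then obtain n m where m: "m \<in> subtopology mtopology N interior_of K n"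
      by blast
    obtain W where W: "openin mtopology W" "subtopology mtopology N interior_of K n = W \<inter> N"
      using openin_interior_of [of "subtopology mtopology N" "K n"] unfolding openin_subtopology by blast
    obtain V where V: "V \<in> \<B>" "m \<in> V" "V \<subseteq> W"
      using \<B>(3) W m by blast
    have "V \<inter> N \<subseteq> K n"
      using V W interior_of_subset [of "subtopology mtopology N" "K n"] by blast
    then have "y \<in> C n V"
      unfolding C_def K_def using y P by blast
    moreover have "V \<inter> N \<noteq> {}"
      using V W m by blast
    ultimately show "y \<in> \<Union>\<C>"
      unfolding \<C>_def using V(1) by (intro UnionI [of "C n V"] image_eqI [of _ _ "(n, V)"]) auto
  qed
  ultimately show ?thesis
    unfolding \<C>_def by (intro exI [of _ \<C>]) (auto simp: \<C>_def)
qed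

end

context invariant_metric_group
begin

text \<open>
  Discarding a nowhere dense part, \<open>P\<close> may be replaced by the set \<open>Q\<close> of its points that lie in the
  interior of its closure. As \<open>Y\<close> is perfect, \<open>Q\<close> has no isolated points. By Lavrentiev's theorem
  \<open>g\<close> extends from \<open>Q\<close> to a \<open>G\<^sub>\<delta>\<close> set \<open>U\<close> in which \<open>Q\<close> is dense; \<open>U\<close> is completely metrizable, and
  the extension is not constant on any nonempty open subset of \<open>U\<close>, since such a set contains two
  points of \<open>Q\<close>.
\<close>

lemma meager_injective_preimage:
  assumes G: "Polish_topology mtopology"
    and A: "meager_additive G mtopology A"
    and Y: "perfect_Polish_topology Y"
    and P: "P \<subseteq> topspace Y"
    and g: "continuous_map (subtopology Y P) mtopology g" "inj_on g P" "g ` P \<subseteq> A"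
  shows "meager_in Y P"
proof -
  have cG: "completely_metrizable_space mtopology"
    and cY: "completely_metrizable_space Y" and perfect: "\<forall>x \<in> topspace Y. \<not> openin Y {x}"
    using G Y unfolding Polish_topology_def perfect_Polish_topology_def by blast+
  have sG: "second_countable mtopology" and sY: "second_countable Y"
    using G Y unfolding perfect_Polish_topology_def by (simp_all add: Polish_topology_second_countable)
  have mY: "metrizable_space Y"
    using cY by (rule completely_metrizable_imp_metrizable_space)
  define W where "W = Y interior_of (Y closure_of P)"
  have W: "openin Y W" "W \<subseteq> Y closure_of P"
    unfolding W_def by (simp_all add: interior_of_subset)
  have thin: "nowhere_dense_in Y (Y closure_of P - W)"
  proof -
    have "closedin Y (Y closure_of P - W)"
      using W by (intro closedin_diff) auto
    moreover have "Y interior_of (Y closure_of P - W) = {}"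
    proof -
      have "Y interior_of (Y closure_of P - W) \<subseteq> W"
        unfolding W_def by (intro interior_of_mono) blast
      then show ?thesis
        using interior_of_subset [of Y "Y closure_of P - W"] by blast
    qed
    ultimately show ?thesis
      unfolding nowhere_dense_in_def by (simp add: closure_of_closedin closedin_subset)
  qed
  define Q where "Q = P \<inter> W"
  have Q: "Q \<subseteq> topspace Y" "Q \<subseteq> P"
    using P unfolding Q_def by auto
  have P_cover: "P \<subseteq> (Y closure_of P - W) \<union> Q"
    using closure_of_subset [OF P] unfolding Q_def by blast
  \<comment> \<open>Deleting a point \<open>p\<close> from the open set \<open>Ob \<inter> W\<close> leaves a nonempty open set, which still meets
    \<open>P\<close> because \<open>P\<close> is dense in \<open>W\<close>.\<close>
  have two: "\<exists>p\<in>Ob \<inter> Q. \<exists>p'\<in>Ob \<inter> Q. p \<noteq> p'" if Ob: "openin Y Ob" "Ob \<inter> Q \<noteq> {}" for Ob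
  proof -
    obtain p where p: "p \<in> Ob" "p \<in> P" "p \<in> W"
      using Ob(2) unfolding Q_def by blast
    have "t1_space Y"
      using mY by (rule metrizable_imp_t1_space)
    then have op: "openin Y (Ob \<inter> W - {p})"
      using Ob(1) W(1) P p(2) by (intro openin_diff openin_Int) (auto simp: t1_space_closedin_singleton)
    have "Ob \<inter> W - {p} \<noteq> {}"
    proof
      assume "Ob \<inter> W - {p} = {}"
      then have "Ob \<inter> W = {p}"
        using p by blast
      then show False
        using perfect openin_Int [OF Ob(1) W(1)] P p(2) by auto
    qed
    then have "(Ob \<inter> W - {p}) \<inter> (Y closure_of P) \<noteq> {}"
      using W(2) by blast
    then have "(Ob \<inter> W - {p}) \<inter> P \<noteq> {}"
      using openin_Int_closure_of_eq_empty [OF op, of P] by simp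
    then obtain p' where "p' \<in> Ob \<inter> W - {p}" "p' \<in> P"
      by blast
    then show ?thesis
      using p unfolding Q_def by blast
  qed
  show ?thesis
  proof (cases "Q = {}")
    case True
    then show ?thesis
      using thin P_cover by (intro meager_in_countable_cover [of "{Y closure_of P - W}"]) auto
  next
    case False
    have "continuous_map (subtopology Y Q) mtopology g"
      using g(1) Q(2) by (rule continuous_map_from_subtopology_mono)
    then have "\<exists>U h. gdelta_in Y U \<and> Q \<subseteq> U \<and> U \<subseteq> Y closure_of Q \<and>
        continuous_map (subtopology Y U) mtopology h \<and> (\<forall>x\<in>Q. h x = g x)"
      by (rule Lavrentiev_extension [OF Q(1) disjI1 [OF mY] cG]) blast
    then obtain U h where U: "gdelta_in Y U" "Q \<subseteq> U" "U \<subseteq> Y closure_of Q"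
      and h: "continuous_map (subtopology Y U) mtopology h" "\<forall>x\<in>Q. h x = g x"
      by blast
    have top_U: "topspace (subtopology Y U) = U"
      using U(3) closure_of_subset_topspace [of Y Q] by auto
    have "completely_metrizable_space (subtopology Y U)"
      by (rule completely_metrizable_space_gdelta_in [OF cY U(1)])
    then obtain Y' \<rho> where \<rho>: "Metric_space Y' \<rho>" "Metric_space.mcomplete Y' \<rho>"
      and sub_eq: "subtopology Y U = Metric_space.mtopology Y' \<rho>"
      unfolding completely_metrizable_space_def by blast
    have Y': "Y' = U"
      using top_U Metric_space.topspace_mtopology [OF \<rho>(1)] sub_eq by simp
    interpret nowhere_constant_map G d Y' \<rho> h
    proof (intro nowhere_constant_map.intro nowhere_constant_map_axioms.intro)
      show "invariant_metric_group G d"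
        by (rule invariant_metric_group_axioms)
      show "second_countable (Metric_space.mtopology Y' \<rho>)"
        using second_countable_subtopology [OF sY, of U] sub_eq by simp
      show "Y' \<noteq> {}"
        using False U(2) Y' by blast
      show "continuous_map (Metric_space.mtopology Y' \<rho>) mtopology h"
        using h(1) sub_eq by simp
      show "\<exists>a\<in>V. \<exists>b\<in>V. h a \<noteq> h b"
        if V: "openin (Metric_space.mtopology Y' \<rho>) V" "V \<noteq> {}" for V
      proof -
        obtain Ob where Ob: "openin Y Ob" "V = Ob \<inter> U"
          using V(1) unfolding sub_eq [symmetric] openin_subtopology by blast
        have "Ob \<inter> Q \<noteq> {}"
          using V(2) Ob(2) U(3) openin_Int_closure_of_eq_empty [OF Ob(1), of Q] by blast
        then obtain p p' where p: "p \<in> Ob \<inter> Q" "p' \<in> Ob \<inter> Q" "p \<noteq> p'"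
          using two [OF Ob(1)] by blast
        then have "h p \<noteq> h p'"
          using h(2) inj_onD [OF g(2)] Q(2) by (metis IntD2 subsetD)
        then show ?thesis
          using p Ob(2) U(2) by blast
      qed
    qed (use \<rho> in auto)
    have "h ` Q \<subseteq> A"
      using h(2) g(3) Q(2) by auto
    then obtain \<C> where \<C>: "countable \<C>" "Q \<subseteq> \<Union>\<C>"
        "\<forall>C\<in>\<C>. closedin (subtopology Y U) C \<and> subtopology Y U interior_of C = {}"
      using closed_cover_of_preimage [OF cG sG A, of Q] U(2) Y' unfolding sub_eq by blast
    show ?thesis
    proof (rule meager_in_countable_cover [of "insert (Y closure_of P - W) \<C>"])
      show "nowhere_dense_in Y C" if "C \<in> insert (Y closure_of P - W) \<C>" for C
        using that thin \<C>(3) nowhere_dense_in_subspaceD [of Y U C] by blast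
      show "P \<subseteq> \<Union> (insert (Y closure_of P - W) \<C>)"
        using P_cover \<C>(2) by auto
    qed (use \<C>(1) in simp)
  qed
qed

end

text \<open>
  Composing \<open>f\<close> with the inverse of the embedding \<open>e\<close> turns the preimage of \<open>A\<close> in \<open>Y\<close> into the
  domain of a continuous injection into the group with values in \<open>A\<close>.
\<close>

theorem proposition6p5:
  fixes G :: "('g, 'm) monoid_scheme"
    and T :: "'g topology"
    and A :: "'g set"
  assumes "Polish_group G T"
    and "\<exists>d. invariant_metric G T d"
    and "meager_additive G T A"
  shows "universally_meager TYPE('y) TYPE('x) (subtopology T A)"
proof -
  interpret Polish_group G T
    by (rule assms(1))
  obtain d where d: "invariant_metric G T d"
    using assms(2) by blast
  interpret invariant_metric_group G d
    using d unfolding invariant_metric_def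
    by (intro invariant_metric_group.intro invariant_metric_group_axioms.intro group_axioms) auto
  have T: "mtopology = T"
    using d unfolding invariant_metric_def by blast
  have metrizable: "metrizable_space T"
    using metrizable_space_mtopology T by simp
  have A: "A \<subseteq> carrier G"
    using assms(3) unfolding meager_additive_def by blast
  have top_A: "topspace (subtopology T A) = A"
    using A topspace_eq_carrier by auto
  show ?thesis
    unfolding universally_meager_def
  proof (intro conjI allI impI)
    show "metrizable_space (subtopology T A)"
      using metrizable by (rule metrizable_space_subtopology)
    show "separable_space (subtopology T A)"
      using Polish by (intro second_countable_imp_separable_space second_countable_subtopology
          Polish_topology_second_countable)
    fix Y :: "'y topology" and X :: "'x topology" and e f
    assume "perfect_Polish_topology Y \<and> perfect_Polish_topology X \<and>
        embedding_map (subtopology T A) X e \<and>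
        continuous_map Y X f \<and> inj_on f (topspace Y)"
    then have Y: "perfect_Polish_topology Y" and e: "embedding_map (subtopology T A) X e"
      and f: "continuous_map Y X f" "inj_on f (topspace Y)"
      by blast+
    obtain e' where e': "homeomorphic_maps (subtopology T A) (subtopology X (e ` A)) e e'"
      using e unfolding embedding_map_def homeomorphic_map_maps top_A by blast
    define P where "P = {y \<in> topspace Y. f y \<in> e ` A}"
    have e'_cont: "continuous_map (subtopology X (e ` A)) (subtopology T A) e'"
      and e'_e: "\<And>x. x \<in> A \<Longrightarrow> e' (e x) = x"
      using e' unfolding homeomorphic_maps_def top_A by blast+
    have "continuous_map (subtopology Y P) (subtopology X (e ` A)) f"
      using f(1) unfolding P_def
      by (intro continuous_map_into_subtopology continuous_map_from_subtopology) auto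
    then have "continuous_map (subtopology Y P) (subtopology T A) (e' \<circ> f)"
      using e'_cont by (rule continuous_map_compose)
    then have g: "continuous_map (subtopology Y P) mtopology (e' \<circ> f)"
      unfolding T by (rule continuous_map_into_fulltopology)
    have "inj_on (e' \<circ> f) P"
    proof (rule inj_onI)
      fix x y
      assume xy: "x \<in> P" "y \<in> P" "(e' \<circ> f) x = (e' \<circ> f) y"
      then obtain a b where "a \<in> A" "f x = e a" "b \<in> A" "f y = e b"
        unfolding P_def by blast
      then have "f x = f y"
        using xy(3) e'_e by simp
      then show "x = y"
        using xy f(2) unfolding P_def inj_on_def by blast
    qed
    moreover have "(e' \<circ> f) ` P \<subseteq> A"
      unfolding P_def using e'_e by auto
    ultimately have "meager_in Y P"
      using assms(3) Polish T g Y
      by (intro meager_injective_preimage [of A Y P "e' \<circ> f"]) (auto simp: P_def)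
    then show "meager_in Y {y \<in> topspace Y. f y \<in> e ` topspace (subtopology T A)}"
      unfolding P_def top_A .
  qed
qed

end
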